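(* For any field $K$, every derivation of $\mathfrak{gl}_{cf}(\mathbb{N},K)$ is inner, and there is an isomorphism of Lie algebras $$\mathrm{Der}(\mathfrak{gl}_{cf}(\mathbb{N},K))\cong\mathfrak{gl}_{cf}(\mathbb{N},K)/\mathfrak{d}_{sc}(\mathbb{N},K).$$
   Context: $\mathbb{N}$ denotes the positive integers. $\mathfrak{gl}_{cf}(\mathbb{N},K)$ is the set of all $\mathbb{N}\times\mathbb{N}$ matrices over $K$ having only finitely many nonzero entries in each column, regarded as a Lie algebra over $K$ with $[A,B]=AB-BA$. $\mathfrak{d}_{sc}(\mathbb{N},K)=\{\alpha E:\alpha\in K\}$, where $E$ is the infinite identity matrix. A derivation of $\mathfrak{gl}_{cf}(\mathbb{N},K)$ is a $K$-linear map $\varphi$ from $\mathfrak{gl}_{cf}(\mathbb{N},K)$ to itself with $\varphi([X,Y])=[\varphi(X),Y]+[X,\varphi(Y)]$ for all $X,Y$; it is inner if it has the form $X\mapsto[A,X]$ for a fixed $A\in\mathfrak{gl}_{cf}(\mathbb{N},K)$. $\mathrm{Der}(\mathfrak{gl}_{cf}(\mathbb{N},K))$ is the Lie algebra of all derivations, with the commutator bracket. *)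

theory Defs
  imports Complex_Main
begin

locale lie_algebra = vector_space scale
  for scale :: "'k::field \<Rightarrow> 'a::ab_group_add \<Rightarrow> 'a" +
  fixes bracket :: "'a \<Rightarrow> 'a \<Rightarrow> 'a"
  assumes bracket_add_left: "bracket (x + y) z = bracket x z + bracket y z"
    and bracket_add_right: "bracket x (y + z) = bracket x y + bracket x z"
    and bracket_scale_left: "bracket (scale c x) y = scale c (bracket x y)"
    and bracket_scale_right: "bracket x (scale c y) = scale c (bracket x y)"
    and bracket_self: "bracket x x = 0"
    and jacobi: "bracket x (bracket y z) + bracket y (bracket z x) + bracket z (bracket x y) = 0"

locale lie_algebra_iso =
  L1: lie_algebra scale1 bracket1 + L2: lie_algebra scale2 bracket2 +
  Vector_Spaces.linear scale1 scale2 f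
  for scale1 :: "'k::field \<Rightarrow> 'a::ab_group_add \<Rightarrow> 'a" and bracket1 :: "'a \<Rightarrow> 'a \<Rightarrow> 'a"
    and scale2 :: "'k \<Rightarrow> 'b::ab_group_add \<Rightarrow> 'b" and bracket2 :: "'b \<Rightarrow> 'b \<Rightarrow> 'b"
    and f :: "'a \<Rightarrow> 'b" +
  assumes bracket_hom: "f (bracket1 x y) = bracket2 (f x) (f y)"
    and bij: "bij f"

definition lie_derivation ::
  "('k::field \<Rightarrow> 'a::ab_group_add \<Rightarrow> 'a) \<Rightarrow> ('a \<Rightarrow> 'a \<Rightarrow> 'a) \<Rightarrow> ('a \<Rightarrow> 'a) \<Rightarrow> bool" where
  "lie_derivation scale bracket \<phi> \<longleftrightarrow> Vector_Spaces.linear scale scale \<phi> \<and>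
     (\<forall>x y. \<phi> (bracket x y) = bracket (\<phi> x) y + bracket x (\<phi> y))"

definition inner_derivation :: "('a \<Rightarrow> 'a \<Rightarrow> 'a) \<Rightarrow> ('a \<Rightarrow> 'a) \<Rightarrow> bool" where
  "inner_derivation bracket \<phi> \<longleftrightarrow> (\<exists>a. \<phi> = (\<lambda>x. bracket a x))"

definition commutator :: "'a::ring \<Rightarrow> 'a \<Rightarrow> 'a" where
  "commutator x y = x * y - y * x"

text \<open>
  Column-finite matrices. Rows and columns are indexed by the type \<open>nat\<close>, that is, the index
  set of the positive integers is relabelled along \<open>n \<mapsto> n - 1\<close>. The first index is the row,
  the second one the column.
\<close>

typedef (overloaded) 'k cf_mat = "{A :: nat \<Rightarrow> nat \<Rightarrow> 'k::zero. \<forall>j. finite {i. A i j \<noteq> 0}}"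
  morphisms entry Cf_Mat
  by (rule exI[of _ "\<lambda>i j. 0"]) simp

setup_lifting type_definition_cf_mat

lemma finite_column [simp]: "finite {i. entry A i j \<noteq> 0}"
  using entry[of A] by simp

lemma cf_mat_eqI: "(\<And>i j. entry A i j = entry B i j) \<Longrightarrow> A = B"
  by (simp add: entry_inject[symmetric] fun_eq_iff)

instantiation cf_mat :: (ab_group_add) ab_group_add
begin

lift_definition zero_cf_mat :: "'a cf_mat" is "\<lambda>i j. 0"
  by simp

lift_definition plus_cf_mat :: "'a cf_mat \<Rightarrow> 'a cf_mat \<Rightarrow> 'a cf_mat" is
  "\<lambda>A B i j. A i j + B i j"
proof -
  fix A B :: "nat \<Rightarrow> nat \<Rightarrow> 'a" and j
  assume "\<And>j. finite {i. A i j \<noteq> 0}" "\<And>j. finite {i. B i j \<noteq> 0}"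
  then have "finite ({i. A i j \<noteq> 0} \<union> {i. B i j \<noteq> 0})"
    by simp
  then show "finite {i. A i j + B i j \<noteq> 0}"
    by (rule rev_finite_subset) auto
qed

lift_definition uminus_cf_mat :: "'a cf_mat \<Rightarrow> 'a cf_mat" is "\<lambda>A i j. - A i j"
  by simp

definition minus_cf_mat :: "'a cf_mat \<Rightarrow> 'a cf_mat \<Rightarrow> 'a cf_mat" where
  "minus_cf_mat A B = A + - B"

instance
  by standard (simp add: minus_cf_mat_def | transfer, simp add: add_ac)+

end

text \<open>
  The entry of a product is a sum over the finite support of a column of the right factor.
\<close>

instantiation cf_mat :: (ring_1) ring_1
begin

lift_definition one_cf_mat :: "'a cf_mat" is "\<lambda>i j. if i = j then 1 else 0"
  by simp

lift_definition times_cf_mat :: "'a cf_mat \<Rightarrow> 'a cf_mat \<Rightarrow> 'a cf_mat" is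
  "\<lambda>A B i j. \<Sum>k | B k j \<noteq> 0. A i k * B k j"
proof -
  fix A B :: "nat \<Rightarrow> nat \<Rightarrow> 'a" and j
  assume "\<And>j. finite {i. A i j \<noteq> 0}" "\<And>j. finite {i. B i j \<noteq> 0}"
  then have "finite (\<Union>k\<in>{k. B k j \<noteq> 0}. {i. A i k \<noteq> 0})"
    by simp
  then show "finite {i. (\<Sum>k | B k j \<noteq> 0. A i k * B k j) \<noteq> 0}"
  proof (rule rev_finite_subset, intro subsetI)
    fix i assume "i \<in> {i. (\<Sum>k | B k j \<noteq> 0. A i k * B k j) \<noteq> 0}"
    then obtain k where "k \<in> {k. B k j \<noteq> 0}" "A i k * B k j \<noteq> 0"
      by (auto elim: sum.not_neutral_contains_not_neutral)
    then show "i \<in> (\<Union>k\<in>{k. B k j \<noteq> 0}. {i. A i k \<noteq> 0})"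
      by auto
  qed
qed

lemma entry_times:
  fixes A B :: "'a cf_mat"
  assumes "finite S" "{k. entry B k j \<noteq> 0} \<subseteq> S"
  shows "entry (A * B) i j = (\<Sum>k\<in>S. entry A i k * entry B k j)"
  unfolding times_cf_mat.rep_eq using assms by (intro sum.mono_neutral_left) auto

instance
proof
  fix A B C :: "'a cf_mat"
  show "A * B * C = A * (B * C)"
  proof (rule cf_mat_eqI)
    fix i j
    let ?T = "{k. entry C k j \<noteq> 0}"
    let ?S = "(\<Union>k\<in>?T. {l. entry B l k \<noteq> 0}) \<union> {l. entry (B * C) l j \<noteq> 0}"
    have S: "finite ?S"
      by auto
    have "entry (A * B * C) i j = (\<Sum>k\<in>?T. entry (A * B) i k * entry C k j)"
      by (rule entry_times) auto
    also have "\<dots> = (\<Sum>k\<in>?T. (\<Sum>l\<in>?S. entry A i l * entry B l k) * entry C k j)"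
      by (intro sum.cong refl arg_cong2[where f = "(*)"] entry_times[OF S]) auto
    also have "\<dots> = (\<Sum>l\<in>?S. \<Sum>k\<in>?T. entry A i l * (entry B l k * entry C k j))"
      by (subst sum.swap) (simp add: sum_distrib_right mult.assoc)
    also have "\<dots> = (\<Sum>l\<in>?S. entry A i l * entry (B * C) l j)"
      by (simp add: sum_distrib_left times_cf_mat.rep_eq)
    also have "\<dots> = entry (A * (B * C)) i j"
      by (rule entry_times[OF S, symmetric]) auto
    finally show "entry (A * B * C) i j = entry (A * (B * C)) i j" .
  qed
  show "1 * A = A"
  proof (rule cf_mat_eqI)
    fix i j
    have "entry (1 * A) i j = (\<Sum>k\<in>insert i {k. entry A k j \<noteq> 0}. entry 1 i k * entry A k j)"
      by (rule entry_times) auto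
    also have "\<dots> = entry A i j"
      by (simp add: one_cf_mat.rep_eq if_distrib[where f = "\<lambda>x. x * _"] cong: if_cong)
    finally show "entry (1 * A) i j = entry A i j" .
  qed
  show "A * 1 = A"
  proof (rule cf_mat_eqI)
    fix i j
    have "entry (A * 1) i j = (\<Sum>k\<in>{j}. entry A i k * entry 1 k j)"
      by (rule entry_times) (auto simp: one_cf_mat.rep_eq)
    then show "entry (A * 1) i j = entry A i j"
      by (simp add: one_cf_mat.rep_eq)
  qed
  show "(A + B) * C = A * C + B * C"
    by (rule cf_mat_eqI)
      (simp add: times_cf_mat.rep_eq plus_cf_mat.rep_eq distrib_right sum.distrib)
  show "A * (B + C) = A * B + A * C"
  proof (rule cf_mat_eqI)
    fix i j
    let ?S = "{k. entry B k j \<noteq> 0} \<union> {k. entry C k j \<noteq> 0}"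
    have "entry (A * (B + C)) i j = (\<Sum>k\<in>?S. entry A i k * entry (B + C) k j)"
      by (rule entry_times) (auto simp: plus_cf_mat.rep_eq)
    also have "\<dots> = (\<Sum>k\<in>?S. entry A i k * entry B k j) + (\<Sum>k\<in>?S. entry A i k * entry C k j)"
      by (simp add: plus_cf_mat.rep_eq distrib_left sum.distrib)
    also have "\<dots> = entry (A * B) i j + entry (A * C) i j"
      by (intro arg_cong2[where f = "(+)"] entry_times[symmetric]) auto
    finally show "entry (A * (B + C)) i j = entry (A * B + A * C) i j"
      by (simp add: plus_cf_mat.rep_eq)
  qed
  show "(0 :: 'a cf_mat) \<noteq> 1"
  proof
    assume "(0 :: 'a cf_mat) = 1"
    then have "entry (0 :: 'a cf_mat) 0 0 = entry 1 0 0"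
      by simp
    then show False
      by (simp add: zero_cf_mat.rep_eq one_cf_mat.rep_eq)
  qed
qed

end

lift_definition cf_scale :: "'k::field \<Rightarrow> 'k cf_mat \<Rightarrow> 'k cf_mat" is "\<lambda>c A i j. c * A i j"
  by (auto intro: finite_subset[rotated])

lemma cf_scale_mult_left: "cf_scale c A * B = cf_scale c (A * B)"
  by (rule cf_mat_eqI)
    (simp add: times_cf_mat.rep_eq cf_scale.rep_eq sum_distrib_left mult.assoc)

lemma cf_scale_mult_right: "A * cf_scale c B = cf_scale c (A * B)"
proof (rule cf_mat_eqI)
  fix i j
  have "entry (A * cf_scale c B) i j = (\<Sum>k | entry B k j \<noteq> 0. entry A i k * entry (cf_scale c B) k j)"
    by (rule entry_times) (auto simp: cf_scale.rep_eq)
  then show "entry (A * cf_scale c B) i j = entry (cf_scale c (A * B)) i j"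
    by (simp add: times_cf_mat.rep_eq cf_scale.rep_eq sum_distrib_left mult.left_commute)
qed

interpretation cf: vector_space cf_scale
  by standard (transfer, simp add: algebra_simps)+

lemma lie_algebra_cf_mat: "lie_algebra cf_scale commutator"
  by standard (simp_all add: commutator_def algebra_simps cf_scale_mult_left cf_scale_mult_right)

interpretation cf: lie_algebra cf_scale commutator
  by (rule lie_algebra_cf_mat)

abbreviation cf_derivation :: "('k::field cf_mat \<Rightarrow> 'k cf_mat) \<Rightarrow> bool" where
  "cf_derivation \<equiv> lie_derivation cf_scale commutator"

lemma cf_derivationD:
  assumes "cf_derivation \<phi>"
  shows "\<phi> (A + B) = \<phi> A + \<phi> B" "\<phi> (cf_scale c A) = cf_scale c (\<phi> A)"
    "\<phi> (commutator A B) = commutator (\<phi> A) B + commutator A (\<phi> B)"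
    "\<phi> (A - B) = \<phi> A - \<phi> B"
proof -
  interpret Vector_Spaces.linear cf_scale cf_scale \<phi>
    using assms by (simp add: lie_derivation_def)
  show "\<phi> (A + B) = \<phi> A + \<phi> B" "\<phi> (cf_scale c A) = cf_scale c (\<phi> A)"
    "\<phi> (A - B) = \<phi> A - \<phi> B"
    by (rule add scale diff)+
  show "\<phi> (commutator A B) = commutator (\<phi> A) B + commutator A (\<phi> B)"
    using assms by (simp add: lie_derivation_def)
qed

lemma cf_derivationI:
  assumes "\<And>A B. \<phi> (A + B) = \<phi> A + \<phi> B" "\<And>c A. \<phi> (cf_scale c A) = cf_scale c (\<phi> A)"
    "\<And>A B. \<phi> (commutator A B) = commutator (\<phi> A) B + commutator A (\<phi> B)"
  shows "cf_derivation \<phi>"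
  using assms by (auto simp: lie_derivation_def intro!: Vector_Spaces.linear.intro
      module_hom.intro module_hom_axioms.intro cf.vector_space_axioms cf.module_axioms)

typedef (overloaded) 'k cf_der = "{\<phi> :: 'k::field cf_mat \<Rightarrow> 'k cf_mat. cf_derivation \<phi>}"
  morphisms der_apply Cf_Der
  by (rule exI[of _ "\<lambda>A. 0"]) (auto intro!: cf_derivationI simp: commutator_def)

setup_lifting type_definition_cf_der

instantiation cf_der :: (field) ab_group_add
begin

lift_definition zero_cf_der :: "'a cf_der" is "\<lambda>A. 0"
  by (auto intro!: cf_derivationI simp: commutator_def)

lift_definition plus_cf_der :: "'a cf_der \<Rightarrow> 'a cf_der \<Rightarrow> 'a cf_der" is "\<lambda>\<phi> \<psi> A. \<phi> A + \<psi> A"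
  by (rule cf_derivationI)
    (simp_all add: cf_derivationD cf.scale_right_distrib cf.bracket_add_left cf.bracket_add_right)

lift_definition uminus_cf_der :: "'a cf_der \<Rightarrow> 'a cf_der" is "\<lambda>\<phi> A. - \<phi> A"
  by (rule cf_derivationI) (simp_all add: cf_derivationD, simp add: commutator_def)

definition minus_cf_der :: "'a cf_der \<Rightarrow> 'a cf_der \<Rightarrow> 'a cf_der" where
  "minus_cf_der \<phi> \<psi> = \<phi> + - \<psi>"

instance
  by standard (simp add: minus_cf_der_def | transfer, simp add: add_ac)+

end

lift_definition der_scale :: "'k::field \<Rightarrow> 'k cf_der \<Rightarrow> 'k cf_der" is "\<lambda>c \<phi> A. cf_scale c (\<phi> A)"
  by (rule cf_derivationI)
    (simp_all add: cf_derivationD cf.scale_right_distrib cf.bracket_scale_left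
      cf.bracket_scale_right mult.commute)

lift_definition der_bracket :: "'k::field cf_der \<Rightarrow> 'k cf_der \<Rightarrow> 'k cf_der" is
  "\<lambda>\<phi> \<psi> A. \<phi> (\<psi> A) - \<psi> (\<phi> A)"
  by (rule cf_derivationI)
    (simp_all add: cf_derivationD cf.scale_right_diff_distrib, simp add: commutator_def algebra_simps)

lemma lie_algebra_cf_der: "lie_algebra der_scale der_bracket"
  by standard (transfer, simp add: cf_derivationD fun_eq_iff algebra_simps)+

definition scalar_mats :: "'k::field cf_mat set" where
  "scalar_mats = {cf_scale \<alpha> 1 | \<alpha>. True}"

lemma scalar_mats_add: "A \<in> scalar_mats \<Longrightarrow> B \<in> scalar_mats \<Longrightarrow> A + B \<in> scalar_mats"
  unfolding scalar_mats_def by (auto simp: cf.scale_left_distrib[symmetric])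

lemma scalar_mats_uminus: "A \<in> scalar_mats \<Longrightarrow> - A \<in> scalar_mats"
  unfolding scalar_mats_def by (auto simp: cf.scale_minus_left[symmetric] simp del: cf.scale_minus_left)

lemma scalar_mats_scale: "A \<in> scalar_mats \<Longrightarrow> cf_scale c A \<in> scalar_mats"
  unfolding scalar_mats_def by auto

lemma scalar_mats_zero: "0 \<in> scalar_mats"
  unfolding scalar_mats_def by (auto intro: exI[of _ 0])

lemma scalar_mats_central: "S \<in> scalar_mats \<Longrightarrow> S * A = A * S"
  unfolding scalar_mats_def by (auto simp: cf_scale_mult_left cf_scale_mult_right)

text \<open>The Lie algebra of column-finite matrices modulo the ideal of scalar matrices.\<close>

quotient_type (overloaded) 'k cf_quot = "'k::field cf_mat" / "\<lambda>A B. A - B \<in> scalar_mats"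
proof (rule equivpI)
  show "reflp (\<lambda>A B :: 'k cf_mat. A - B \<in> scalar_mats)"
    by (auto intro!: reflpI simp: scalar_mats_zero)
  show "symp (\<lambda>A B :: 'k cf_mat. A - B \<in> scalar_mats)"
    by (rule sympI) (metis minus_diff_eq scalar_mats_uminus)
  show "transp (\<lambda>A B :: 'k cf_mat. A - B \<in> scalar_mats)"
    by (rule transpI) (metis diff_add_cancel add_diff_eq scalar_mats_add)
qed

instantiation cf_quot :: (field) ab_group_add
begin

lift_definition zero_cf_quot :: "'a cf_quot" is "0" .

lift_definition plus_cf_quot :: "'a cf_quot \<Rightarrow> 'a cf_quot \<Rightarrow> 'a cf_quot" is "\<lambda>A B. A + B"
  by (metis add_diff_add scalar_mats_add)

lift_definition uminus_cf_quot :: "'a cf_quot \<Rightarrow> 'a cf_quot" is "\<lambda>A. - A"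
  by (metis minus_diff_minus scalar_mats_uminus)

definition minus_cf_quot :: "'a cf_quot \<Rightarrow> 'a cf_quot \<Rightarrow> 'a cf_quot" where
  "minus_cf_quot x y = x + - y"

instance
  by standard (simp add: minus_cf_quot_def | transfer, simp add: algebra_simps scalar_mats_zero)+

end

lift_definition quot_scale :: "'k::field \<Rightarrow> 'k cf_quot \<Rightarrow> 'k cf_quot" is cf_scale
  by (metis cf.scale_right_diff_distrib scalar_mats_scale)

lift_definition quot_bracket :: "'k::field cf_quot \<Rightarrow> 'k cf_quot \<Rightarrow> 'k cf_quot" is commutator
proof -
  fix A A' B B' :: "'k cf_mat"
  assume A: "A - A' \<in> scalar_mats" and B: "B - B' \<in> scalar_mats"
  have "commutator A B - commutator A' B' =
      ((A - A') * B - B * (A - A')) + (A' * (B - B') - (B - B') * A')"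
    by (simp add: commutator_def left_diff_distrib right_diff_distrib)
  also have "\<dots> = 0"
    by (simp only: scalar_mats_central[OF A] scalar_mats_central[OF B] diff_self add_0_left)
  finally have "commutator A B - commutator A' B' = 0" .
  then show "commutator A B - commutator A' B' \<in> scalar_mats"
    by (simp add: scalar_mats_zero)
qed

lemma lie_algebra_cf_quot: "lie_algebra quot_scale quot_bracket"
  by standard
    (transfer, simp add: scalar_mats_zero cf.bracket_add_left cf.bracket_add_right
      cf.bracket_scale_left cf.bracket_scale_right cf.bracket_self cf.jacobi
      cf.scale_left_distrib cf.scale_right_distrib)+

end

theory Submission
  imports Defs
begin

text \<open>
  Column-finite matrices are the endomorphisms of a space with basis \<open>v\<^sub>0, v\<^sub>1, \<dots>\<close>; write
  \<open>e\<^sub>i\<^sub>j\<close> for the matrix units. Given a derivation \<open>\<phi>\<close>, a matrix \<open>A\<close> can be read off from single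
  columns of the matrices \<open>\<phi> e\<^sub>b\<^sub>b\<close> and \<open>\<phi> e\<^sub>b\<^sub>0\<close>, which is why it is column-finite. It is chosen
  so that \<open>\<psi> = \<phi> - [A, \<cdot>]\<close> maps every \<open>e\<^sub>i\<^sub>i\<close> to a diagonal matrix and the
  \<open>(i, 0)\<close> entry of \<open>\<psi> e\<^sub>i\<^sub>0\<close> is zero for \<open>i \<noteq> 0\<close>. The relations between matrix units then give \<open>\<psi> e\<^sub>i\<^sub>j = 0\<close> for
  \<open>i \<noteq> j\<close> (\<open>derivation_unit_eq_0\<close>). Bracketing an arbitrary matrix \<open>X\<close> with such units on both
  sides isolates its entries, and this forces \<open>\<psi> X\<close> to be a scalar matrix
  (\<open>derivation_scalar_valued\<close>).

  A derivation with scalar values vanishes on commutators. In infinite size there is no trace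
  obstruction: every column-finite matrix is a commutator with the shift matrix
  (\<open>shift_commutator\<close>). Hence \<open>\<psi> = 0\<close> and \<open>\<phi>\<close> is inner. The small characteristics
  need no separate treatment because further indices are always at hand.

  The isomorphism sends a derivation to the class of any matrix inducing it; this class is unique
  because only scalar matrices are central (\<open>commutator_eq_imp_diff_scalar\<close>).
\<close>

section \<open>Matrix units\<close>

lift_definition unit_mat :: "nat \<Rightarrow> nat \<Rightarrow> 'k::field cf_mat" is
  "\<lambda>i j a b. if a = i \<and> b = j then 1 else 0"
  by simp

lemma entry_diff: "entry (A - B) i j = entry A i j - entry B i j"
  for A B :: "'k::field cf_mat"
  by (simp only: minus_cf_mat_def plus_cf_mat.rep_eq uminus_cf_mat.rep_eq diff_conv_add_uminus)

lemmas entry_simps = entry_diff zero_cf_mat.rep_eq plus_cf_mat.rep_eq unit_mat.rep_eq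
  cf_scale.rep_eq one_cf_mat.rep_eq

lemma entry_times_unit: "entry (A * unit_mat i j) a b = (if b = j then entry A a i else 0)"
  by (subst entry_times[of "{i}"]) (auto simp: unit_mat.rep_eq)

lemma entry_unit_times: "entry (unit_mat i j * A) a b = (if a = i then entry A j b else 0)"
proof -
  have "entry (unit_mat i j * A) a b =
      (\<Sum>k\<in>insert j {k. entry A k b \<noteq> 0}. entry (unit_mat i j) a k * entry A k b)"
    by (rule entry_times) auto
  also have "\<dots> = (\<Sum>k\<in>insert j {k. entry A k b \<noteq> 0}. if k = j then (if a = i then entry A j b else 0) else 0)"
    by (rule sum.cong) (auto simp: unit_mat.rep_eq)
  finally show ?thesis
    by simp
qed

lemma entry_commutator_unit:
  "entry (commutator A (unit_mat i j)) a b =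
    (if b = j then entry A a i else 0) - (if a = i then entry A j b else 0)"
  "entry (commutator (unit_mat i j) A) a b =
    (if a = i then entry A j b else 0) - (if b = j then entry A a i else 0)"
  by (simp_all add: commutator_def entry_diff entry_times_unit entry_unit_times)

lemma commutator_unit_unit:
  "commutator (unit_mat i j) (unit_mat k l) =
    (if j = k then unit_mat i l else 0) - (if l = i then unit_mat k j else 0 :: 'k::field cf_mat)"
  by (rule cf_mat_eqI) (auto simp: entry_commutator_unit entry_simps)

section \<open>Derivations and the values on matrix units\<close>

lemma derivation_zero: "cf_derivation \<phi> \<Longrightarrow> \<phi> 0 = 0"
  using cf_derivationD(4)[of \<phi> 0 0] by simp

lemma cf_derivation_ad: "cf_derivation (commutator A)"
proof (rule cf_derivationI)
  fix X Y
  show "commutator A (commutator X Y) =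
      commutator (commutator A X) Y + commutator X (commutator A Y)"
    by (simp add: commutator_def algebra_simps)
qed (simp_all add: cf.bracket_add_right cf.bracket_scale_right)

lemma cf_derivation_diff:
  assumes "cf_derivation \<phi>" "cf_derivation \<psi>"
  shows "cf_derivation (\<lambda>X. \<phi> X - \<psi> X)"
  by (rule cf_derivationI)
    (simp_all add: cf_derivationD[OF assms(1)] cf_derivationD[OF assms(2)]
      cf.scale_right_diff_distrib, simp add: commutator_def algebra_simps)

text \<open>
  Both equations are entries of the derivation rule applied to a commuting pair
  \<open>e\<^sub>i\<^sub>i\<close>, \<open>e\<^sub>b\<^sub>b\<close>. They say that off the diagonal \<open>\<phi> e\<^sub>i\<^sub>i\<close> looks like
  \<open>[A, e\<^sub>i\<^sub>i]\<close> with one matrix \<open>A\<close> for all \<open>i\<close>.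
\<close>

lemma derivation_diagonal_unit:
  assumes "cf_derivation \<phi>" "a \<noteq> b"
  shows "a \<noteq> i \<Longrightarrow> b \<noteq> i \<Longrightarrow> entry (\<phi> (unit_mat i i)) a b = 0"
    and "entry (\<phi> (unit_mat a a)) a b = - entry (\<phi> (unit_mat b b)) a b"
proof -
  have *: "entry (commutator (\<phi> (unit_mat i i)) (unit_mat b b)
      + commutator (unit_mat i i) (\<phi> (unit_mat b b))) a b = 0" if "i \<noteq> b" for i
  proof -
    have "commutator (unit_mat i i) (unit_mat b b :: 'a cf_mat) = 0"
      using that by (auto simp: commutator_unit_unit)
    then show ?thesis
      using cf_derivationD(3)[OF assms(1), of "unit_mat i i" "unit_mat b b"]
      by (simp add: derivation_zero[OF assms(1)] entry_simps)
  qed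
  show "entry (\<phi> (unit_mat i i)) a b = 0" if "a \<noteq> i" "b \<noteq> i"
    using *[of i] that assms(2) by (auto simp: entry_simps entry_commutator_unit)
  show "entry (\<phi> (unit_mat a a)) a b = - entry (\<phi> (unit_mat b b)) a b"
    using *[of a] assms(2)
    by (simp add: entry_simps entry_commutator_unit eq_neg_iff_add_eq_0)
qed

text \<open>
  The derivation rule for \<open>e\<^sub>i\<^sub>j = [e\<^sub>i\<^sub>i, e\<^sub>i\<^sub>j] = [e\<^sub>i\<^sub>j, e\<^sub>j\<^sub>j]\<close> confines the value at \<open>e\<^sub>i\<^sub>j\<close>
  to the positions \<open>(i, j)\<close> and \<open>(j, i)\<close>. The second position survives only in characteristic 2;
  writing \<open>e\<^sub>i\<^sub>j = [e\<^sub>i\<^sub>k, e\<^sub>k\<^sub>j]\<close> with a third index \<open>k\<close> excludes it. The same relation makes the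
  coefficient of \<open>e\<^sub>i\<^sub>j\<close> additive, so it is determined by the coefficients with \<open>j = 0\<close>.
\<close>

lemma derivation_unit_eq_0:
  assumes der: "cf_derivation \<psi>"
    and diag: "\<And>i a b. a \<noteq> b \<Longrightarrow> entry (\<psi> (unit_mat i i)) a b = 0"
    and norm: "\<And>i. i \<noteq> 0 \<Longrightarrow> entry (\<psi> (unit_mat i 0)) i 0 = 0"
    and "i \<noteq> j"
  shows "\<psi> (unit_mat i j) = 0"
proof -
  let ?\<alpha> = "\<lambda>i j. entry (\<psi> (unit_mat i j)) i j"
  have supp: "entry (\<psi> (unit_mat i j)) a b = 0"
    if "i \<noteq> j" "(a, b) \<noteq> (i, j)" "(a, b) \<noteq> (j, i)" for i j a b
  proof -
    have "unit_mat i j = commutator (unit_mat i i) (unit_mat i j :: 'a cf_mat)"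
      "unit_mat i j = commutator (unit_mat i j) (unit_mat j j :: 'a cf_mat)"
      using \<open>i \<noteq> j\<close> by (auto simp: commutator_unit_unit)
    then have
      "\<psi> (unit_mat i j) = commutator (\<psi> (unit_mat i i)) (unit_mat i j)
        + commutator (unit_mat i i) (\<psi> (unit_mat i j))"
      "\<psi> (unit_mat i j) = commutator (\<psi> (unit_mat i j)) (unit_mat j j)
        + commutator (unit_mat i j) (\<psi> (unit_mat j j))"
      by (metis cf_derivationD(3)[OF der])+
    from this(1)[THEN arg_cong, of "\<lambda>M. entry M a b"]
      this(2)[THEN arg_cong, of "\<lambda>M. entry M a b"]
    show ?thesis
      using that diag[of a i i] diag[of j b i] diag[of a i j] diag[of j b j]
      by (auto simp: entry_simps entry_commutator_unit split: if_splits)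
  qed
  have triple: "\<psi> (unit_mat i j) = commutator (\<psi> (unit_mat i k)) (unit_mat k j)
      + commutator (unit_mat i k) (\<psi> (unit_mat k j))" if "i \<noteq> j" for i j k
  proof -
    have "unit_mat i j = commutator (unit_mat i k) (unit_mat k j :: 'a cf_mat)"
      using that by (auto simp: commutator_unit_unit)
    then show ?thesis
      by (metis cf_derivationD(3)[OF der])
  qed
  have transposed: "entry (\<psi> (unit_mat i j)) j i = 0" if "i \<noteq> j" for i j
  proof -
    obtain k where "k \<noteq> i" "k \<noteq> j"
      by (metis UNIV_I finite.emptyI finite.insertI ex_new_if_finite infinite_UNIV_nat insertCI)
    then show ?thesis
      using that by (subst triple[OF that, of k]) (auto simp: entry_simps entry_commutator_unit)
  qed
  have additive: "?\<alpha> i j = ?\<alpha> i k + ?\<alpha> k j" if "i \<noteq> j" "k \<noteq> i" "k \<noteq> j" for i j k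
    using that by (subst triple[OF that(1), of k]) (auto simp: entry_simps entry_commutator_unit)
  have "?\<alpha> i j = 0"
  proof (cases "j = 0")
    case True
    then show ?thesis
      using norm \<open>i \<noteq> j\<close> by simp
  next
    case False
    have off: "?\<alpha> k l = 0" if "k \<noteq> l" "k \<noteq> 0" "l \<noteq> 0" for k l
      using additive[of k 0 l] norm[of k] norm[of l] that by simp
    show ?thesis
    proof (cases "i = 0")
      case True
      have "?\<alpha> (Suc j) j = ?\<alpha> (Suc j) 0 + ?\<alpha> 0 j"
        using False by (intro additive) auto
      then show ?thesis
        using off[of "Suc j" j] norm[of "Suc j"] False True by simp
    next
      case i: False
      then show ?thesis
        using off \<open>i \<noteq> j\<close> False by blast
    qed
  qed
  then show ?thesis
    using supp[OF \<open>i \<noteq> j\<close>] transposed[OF \<open>i \<noteq> j\<close>]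
    by (intro cf_mat_eqI) (metis prod.inject zero_cf_mat.rep_eq)
qed

section \<open>Scalar matrices and commutators\<close>

lemma scalar_matsI:
  assumes "\<And>i j. i \<noteq> j \<Longrightarrow> entry A i j = 0" "\<And>i j. i \<noteq> j \<Longrightarrow> entry A i i = entry A j j"
  shows "A \<in> scalar_mats"
proof -
  have "A = cf_scale (entry A 0 0) 1"
    using assms by (intro cf_mat_eqI) (auto simp: entry_simps, metis)
  then show ?thesis
    unfolding scalar_mats_def by blast
qed

text \<open>
  For \<open>j \<noteq> k\<close> and \<open>i\<close>, \<open>l\<close> different from each other and from \<open>j\<close>, \<open>k\<close>, the double
  commutator \<open>[e\<^sub>i\<^sub>j, [X, e\<^sub>k\<^sub>l]]\<close> equals \<open>X\<^sub>j\<^sub>k e\<^sub>i\<^sub>l + X\<^sub>l\<^sub>i e\<^sub>k\<^sub>j\<close>. The derivation kills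
  these units and commutes with both brackets, so \<open>(\<psi> X)\<^sub>j\<^sub>k = 0\<close>. As all values of \<open>\<psi>\<close> are
  thus diagonal, so is \<open>[\<psi> X, e\<^sub>i\<^sub>j] = \<psi> [X, e\<^sub>i\<^sub>j]\<close>, which makes the diagonal of \<open>\<psi> X\<close> constant.
\<close>

lemma derivation_scalar_valued:
  assumes der: "cf_derivation \<psi>"
    and unit: "\<And>i j. i \<noteq> j \<Longrightarrow> \<psi> (unit_mat i j) = 0"
  shows "\<psi> X \<in> scalar_mats"
proof -
  have comm: "\<psi> (commutator X (unit_mat i j)) = commutator (\<psi> X) (unit_mat i j)"
    "\<psi> (commutator (unit_mat i j) X) = commutator (unit_mat i j) (\<psi> X)"
    if "i \<noteq> j" for X i j
    using that by (simp_all add: cf_derivationD(3)[OF der] unit, simp_all add: commutator_def)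
  have off_diagonal: "entry (\<psi> X) j k = 0" if "j \<noteq> k" for X j k
  proof -
    define i l where "i = j + k + 1" and "l = j + k + 2"
    have ne: "i \<noteq> j" "i \<noteq> k" "l \<noteq> j" "l \<noteq> k" "i \<noteq> l"
      by (auto simp: i_def l_def)
    have double: "commutator (unit_mat i j) (commutator Y (unit_mat k l)) =
        cf_scale (entry Y j k) (unit_mat i l) + cf_scale (entry Y l i) (unit_mat k j)" for Y
      using ne that by (intro cf_mat_eqI) (auto simp: entry_commutator_unit entry_simps)
    have "commutator (unit_mat i j) (commutator (\<psi> X) (unit_mat k l)) =
        \<psi> (commutator (unit_mat i j) (commutator X (unit_mat k l)))"
      using ne by (simp add: comm)
    also have "\<dots> = 0"
      using ne that by (simp add: double cf_derivationD[OF der] unit)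
    finally have "entry (commutator (unit_mat i j) (commutator (\<psi> X) (unit_mat k l))) i l = 0"
      by (simp add: entry_simps)
    then show ?thesis
      using ne by (simp add: double entry_simps)
  qed
  show ?thesis
  proof (rule scalar_matsI)
    show "entry (\<psi> X) i j = 0" if "i \<noteq> j" for i j
      using off_diagonal that .
    show "entry (\<psi> X) i i = entry (\<psi> X) j j" if "i \<noteq> j" for i j
      using off_diagonal[OF that, of "commutator X (unit_mat i j)"] that
      by (simp add: comm entry_commutator_unit)
  qed
qed

lift_definition shift_mat :: "'k::field cf_mat" is "\<lambda>i j. if i = Suc j then 1 else 0"
  by simp

lemma entry_times_shift: "entry (A * shift_mat) i j = entry A i (Suc j)"
  by (subst entry_times[of "{Suc j}"]) (auto simp: shift_mat.rep_eq)

lemma entry_shift_times: "entry (shift_mat * A) i j = (if i = 0 then 0 else entry A (i - 1) j)"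
proof -
  let ?S = "insert (i - 1) {k. entry A k j \<noteq> 0}"
  have "entry (shift_mat * A) i j = (\<Sum>k\<in>?S. entry shift_mat i k * entry A k j)"
    by (rule entry_times) auto
  also have "\<dots> = (\<Sum>k\<in>?S. if k = i - 1 then (if i = 0 then 0 else entry A (i - 1) j) else 0)"
    by (rule sum.cong) (auto simp: shift_mat.rep_eq)
  finally show ?thesis
    by simp
qed

text \<open>
  Column \<open>j\<close> of the equation \<open>S T - T S = X\<close> for the shift \<open>S\<close> reads
  \<open>T v\<^bsub>j+1\<^esub> = S (T v\<^sub>j) - X v\<^sub>j\<close>, so the columns of \<open>T\<close> can be solved for one after the other.
\<close>

primrec shift_solution :: "'k::field cf_mat \<Rightarrow> nat \<Rightarrow> nat \<Rightarrow> 'k" where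
  "shift_solution X 0 = (\<lambda>i. 0)"
| "shift_solution X (Suc j) =
    (\<lambda>i. (if i = 0 then 0 else shift_solution X j (i - 1)) - entry X i j)"

lemma finite_shift_solution: "finite {i. shift_solution X j i \<noteq> 0}"
proof (induction j)
  case (Suc j)
  have "{i. shift_solution X (Suc j) i \<noteq> 0} \<subseteq>
      Suc ` {i. shift_solution X j i \<noteq> 0} \<union> {i. entry X i j \<noteq> 0}"
  proof
    fix i assume "i \<in> {i. shift_solution X (Suc j) i \<noteq> 0}"
    then show "i \<in> Suc ` {i. shift_solution X j i \<noteq> 0} \<union> {i. entry X i j \<noteq> 0}"
      by (cases i) auto
  qed
  then show ?case
    by (rule finite_subset) (use Suc in auto)
qed simp

lemma shift_commutator: "\<exists>T. X = commutator shift_mat T"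
proof -
  define T where "T = Cf_Mat (\<lambda>i j. shift_solution X j i)"
  have T: "entry T i j = shift_solution X j i" for i j
    unfolding T_def by (subst Cf_Mat_inverse) (auto simp: finite_shift_solution)
  have "X = commutator shift_mat T"
    by (rule cf_mat_eqI)
      (simp add: commutator_def entry_diff entry_times_shift entry_shift_times T)
  then show ?thesis ..
qed

lemma commutator_scalar:
  assumes "S \<in> scalar_mats"
  shows "commutator S X = 0" "commutator X S = 0"
  using scalar_mats_central[OF assms, of X] by (simp_all add: commutator_def)

lemma scalar_valued_derivation_eq_0:
  assumes "cf_derivation \<psi>" "\<And>X. \<psi> X \<in> scalar_mats"
  shows "\<psi> X = 0"
proof -
  obtain T where "X = commutator shift_mat T"
    using shift_commutator by blast
  then show ?thesis
    by (simp add: cf_derivationD(3)[OF assms(1)] commutator_scalar assms(2))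
qed

section \<open>The inducing matrix and its uniqueness\<close>

theorem derivation_inner:
  assumes der: "cf_derivation \<phi>"
  shows "\<exists>A. \<phi> = commutator A"
proof -
  \<comment> \<open>
    The entries off the diagonal are forced: \<open>[A, e\<^sub>b\<^sub>b]\<close> has \<open>A\<^sub>a\<^sub>b\<close> at position \<open>(a, b)\<close>. Those
    on the diagonal matter up to a common constant, fixed here by \<open>A\<^sub>0\<^sub>0 = 0\<close>.
  \<close>
  define A where "A = Cf_Mat (\<lambda>a b. if a \<noteq> b then entry (\<phi> (unit_mat b b)) a b
    else if b = 0 then 0 else entry (\<phi> (unit_mat b 0)) b 0)"
  have A: "entry A a b = (if a \<noteq> b then entry (\<phi> (unit_mat b b)) a b
      else if b = 0 then 0 else entry (\<phi> (unit_mat b 0)) b 0)" for a b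
    unfolding A_def
  proof (subst Cf_Mat_inverse, safe)
    fix b
    show "finite {a. (if a \<noteq> b then entry (\<phi> (unit_mat b b)) a b
        else if b = 0 then 0 else entry (\<phi> (unit_mat b 0)) b 0) \<noteq> 0}"
      by (rule finite_subset[of _ "insert b {a. entry (\<phi> (unit_mat b b)) a b \<noteq> 0}"]) auto
  qed
  define \<psi> where "\<psi> = (\<lambda>X. \<phi> X - commutator A X)"
  have \<psi>: "cf_derivation \<psi>"
    unfolding \<psi>_def by (intro cf_derivation_diff der cf_derivation_ad)
  have diag: "entry (\<psi> (unit_mat i i)) a b = 0" if "a \<noteq> b" for i a b
    using that derivation_diagonal_unit(1)[OF der that, of i] derivation_diagonal_unit(2)[OF der that]
    by (auto simp: \<psi>_def entry_diff entry_commutator_unit A)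
  have norm: "entry (\<psi> (unit_mat i 0)) i 0 = 0" if "i \<noteq> 0" for i
    using that by (simp add: \<psi>_def entry_diff entry_commutator_unit A)
  have "\<psi> (unit_mat i j) = 0" if "i \<noteq> j" for i j
    using derivation_unit_eq_0[OF \<psi> diag norm that] .
  then have "\<psi> X = 0" for X
    by (rule scalar_valued_derivation_eq_0[OF \<psi> derivation_scalar_valued[OF \<psi>]])
  then have "\<phi> = commutator A"
    by (simp add: \<psi>_def fun_eq_iff)
  then show ?thesis ..
qed

lemma commutator_eq_imp_diff_scalar:
  fixes A B :: "'k::field cf_mat"
  assumes "commutator A = commutator B"
  shows "A - B \<in> scalar_mats"
proof -
  have "commutator (A - B) X = commutator A X - commutator B X" for X
    by (simp add: commutator_def algebra_simps)
  then have "entry (commutator (A - B) (unit_mat i j)) a b = 0" for i j a b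
    by (simp add: assms zero_cf_mat.rep_eq)
  then have *: "(if b = j then entry (A - B) a i else 0) = (if a = i then entry (A - B) j b else 0)"
    for i j a b
    by (simp only: entry_commutator_unit right_minus_eq)
  show ?thesis
  proof (rule scalar_matsI)
    show "entry (A - B) i j = 0" if "i \<noteq> j" for i j
      using *[of j j i j] that by simp
    show "entry (A - B) i i = entry (A - B) j j" for i j
      using *[of j j i i] by simp
  qed
qed

definition inducing_class :: "'k::field cf_der \<Rightarrow> 'k cf_quot" where
  "inducing_class \<phi> = abs_cf_quot (SOME A. der_apply \<phi> = commutator A)"

lemma inducing_class_eq:
  assumes "der_apply \<phi> = commutator A"
  shows "inducing_class \<phi> = abs_cf_quot A"
proof -
  have "der_apply \<phi> = commutator (SOME A. der_apply \<phi> = commutator A)"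
    using assms by (rule someI)
  then show ?thesis
    unfolding inducing_class_def cf_quot.abs_eq_iff
    using assms by (intro commutator_eq_imp_diff_scalar) simp
qed

lemma der_apply_eq_commutator: "\<exists>A. der_apply \<phi> = commutator A"
  using derivation_inner der_apply by blast

lemma lie_algebra_iso_inducing_class:
  "lie_algebra_iso der_scale der_bracket quot_scale quot_bracket inducing_class"
proof -
  interpret D: lie_algebra der_scale der_bracket
    by (rule lie_algebra_cf_der)
  interpret Q: lie_algebra quot_scale quot_bracket
    by (rule lie_algebra_cf_quot)
  show ?thesis
  proof unfold_locales
    fix \<phi> \<psi> :: "'a cf_der" and c :: 'a
    obtain A where A: "der_apply \<phi> = commutator A"
      using der_apply_eq_commutator by blast
    obtain B where B: "der_apply \<psi> = commutator B"
      using der_apply_eq_commutator by blast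
    have "der_apply (\<phi> + \<psi>) = commutator (A + B)"
      by (simp add: plus_cf_der.rep_eq A B fun_eq_iff cf.bracket_add_left)
    then show "inducing_class (\<phi> + \<psi>) = inducing_class \<phi> + inducing_class \<psi>"
      by (simp add: inducing_class_eq A B plus_cf_quot.abs_eq)
    have "der_apply (der_scale c \<phi>) = commutator (cf_scale c A)"
      by (simp add: der_scale.rep_eq A fun_eq_iff cf.bracket_scale_left)
    then show "inducing_class (der_scale c \<phi>) = quot_scale c (inducing_class \<phi>)"
      by (simp add: inducing_class_eq A quot_scale.abs_eq)
    have "der_apply (der_bracket \<phi> \<psi>) = commutator (commutator A B)"
      by (simp add: der_bracket.rep_eq A B fun_eq_iff) (simp add: commutator_def algebra_simps)
    then show "inducing_class (der_bracket \<phi> \<psi>) = quot_bracket (inducing_class \<phi>) (inducing_class \<psi>)"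
      by (simp add: inducing_class_eq A B quot_bracket.abs_eq)
  next
    show "bij (inducing_class :: 'a cf_der \<Rightarrow> 'a cf_quot)"
    proof (rule bijI)
      show "inj (inducing_class :: 'a cf_der \<Rightarrow> 'a cf_quot)"
      proof (rule injI)
        fix \<phi> \<psi> :: "'a cf_der"
        assume eq: "inducing_class \<phi> = inducing_class \<psi>"
        obtain A where A: "der_apply \<phi> = commutator A"
          using der_apply_eq_commutator by blast
        obtain B where B: "der_apply \<psi> = commutator B"
          using der_apply_eq_commutator by blast
        have AB: "A - B \<in> scalar_mats"
          using eq by (simp add: inducing_class_eq A B cf_quot.abs_eq_iff)
        have "commutator A X = commutator (A - B) X + commutator B X" for X
          by (simp add: cf.bracket_add_left[symmetric])
        then have "commutator A = commutator B"
          by (simp add: commutator_scalar[OF AB] fun_eq_iff)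
        then show "\<phi> = \<psi>"
          using A B by (simp add: der_apply_inject[symmetric])
      qed
      show "surj (inducing_class :: 'a cf_der \<Rightarrow> 'a cf_quot)"
      proof (rule surjI)
        fix q :: "'a cf_quot"
        have "der_apply (Cf_Der (commutator (rep_cf_quot q))) = commutator (rep_cf_quot q)"
          by (rule Cf_Der_inverse) (simp add: cf_derivation_ad)
        then show "inducing_class (Cf_Der (commutator (rep_cf_quot q))) = q"
          by (simp add: inducing_class_eq Quotient_abs_rep[OF Quotient_cf_quot])
      qed
    qed
  qed
qed

theorem corollary1p6:
  shows "(\<forall>\<phi> :: 'k::field cf_mat \<Rightarrow> 'k cf_mat.
            lie_derivation cf_scale commutator \<phi> \<longrightarrow> inner_derivation commutator \<phi>) \<and>
         (\<exists>f :: 'k cf_der \<Rightarrow> 'k cf_quot.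
            lie_algebra_iso der_scale der_bracket quot_scale quot_bracket f)"
  using derivation_inner lie_algebra_iso_inducing_class unfolding inner_derivation_def by blast

end
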